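(* Let $\Omega$ be a domain in $\mathbb{R}^3$, let $q$ be a complex-valued function in $\Omega$, and let $f$ be a nonvanishing complex-valued solution of the Schrödinger equation $(-\Delta+q)f=0$ in $\Omega$. Assume that $f$ is a function of a harmonic function $\rho$. Then $$\psi=f\,\mathcal{A}\!\left[\frac{\nabla\rho}{f^2}\right]$$ is necessarily a solution of $(-\Delta+q)\psi=0$ in $\Omega$.
   Context: $\Delta$ is the Laplacian in $\mathbb{R}^3$ and $\operatorname{rot}$ is the curl. For a complex vector field $\mathbf{\Psi}=(\Psi_1,\Psi_2,\Psi_3)$ with $\operatorname{rot}\mathbf{\Psi}\equiv0$, $\mathcal{A}[\mathbf{\Psi}]$ denotes its scalar potential, i.e. a complex-valued function $\varphi$ with $\nabla\varphi=\mathbf{\Psi}$, reconstructed up to an arbitrary complex constant $c$ by $$\mathcal{A}[\mathbf{\Psi}](x,y,z)=\int_{x_0}^{x}\Psi_1(\xi,y_0,z_0)\,d\xi+\int_{y_0}^{y}\Psi_2(x,\eta,z_0)\,d\eta+\int_{z_0}^{z}\Psi_3(x,y,\zeta)\,d\zeta+c,$$ where $(x_0,y_0,z_0)$ is an arbitrary point in the domain of interest. *)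

theory Defs
  imports "HOL-Analysis.Analysis"
begin

definition partial_deriv :: "3 \<Rightarrow> (real^3 \<Rightarrow> 'a::real_normed_vector) \<Rightarrow> real^3 \<Rightarrow> 'a" where
  "partial_deriv i u p = vector_derivative (\<lambda>t. u (p + t *\<^sub>R axis i 1)) (at 0)"

definition grad :: "(real^3 \<Rightarrow> 'a::real_normed_vector) \<Rightarrow> real^3 \<Rightarrow> 'a^3" where
  "grad u p = (\<chi> i. partial_deriv i u p)"

definition laplacian :: "(real^3 \<Rightarrow> 'a::real_normed_vector) \<Rightarrow> real^3 \<Rightarrow> 'a" where
  "laplacian u p = (\<Sum>i\<in>UNIV. partial_deriv i (partial_deriv i u) p)"

definition rot :: "(real^3 \<Rightarrow> 'a::real_normed_vector^3) \<Rightarrow> real^3 \<Rightarrow> 'a^3" where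
  "rot \<Psi> p = vector
     [partial_deriv 2 (\<lambda>x. \<Psi> x $ 3) p - partial_deriv 3 (\<lambda>x. \<Psi> x $ 2) p,
      partial_deriv 3 (\<lambda>x. \<Psi> x $ 1) p - partial_deriv 1 (\<lambda>x. \<Psi> x $ 3) p,
      partial_deriv 1 (\<lambda>x. \<Psi> x $ 2) p - partial_deriv 2 (\<lambda>x. \<Psi> x $ 1) p]"

(* C1_on and C2_on are the usual classes of continuously differentiable functions
   when S is open, the only case in which they are used. *)
definition C1_on :: "(real^3) set \<Rightarrow> (real^3 \<Rightarrow> 'a::real_normed_vector) \<Rightarrow> bool" where
  "C1_on S u \<longleftrightarrow> (\<forall>p\<in>S. u differentiable (at p)) \<and> (\<forall>i. continuous_on S (partial_deriv i u))"

definition C2_on :: "(real^3) set \<Rightarrow> (real^3 \<Rightarrow> 'a::real_normed_vector) \<Rightarrow> bool" where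
  "C2_on S u \<longleftrightarrow> C1_on S u \<and> (\<forall>i. C1_on S (partial_deriv i u))"

definition harmonic_on :: "(real^3) set \<Rightarrow> (real^3 \<Rightarrow> real) \<Rightarrow> bool" where
  "harmonic_on S \<rho> \<longleftrightarrow> C2_on S \<rho> \<and> (\<forall>p\<in>S. laplacian \<rho> p = 0)"

(* Solutions are classical. *)
definition schroedinger_solution_on ::
    "(real^3) set \<Rightarrow> (real^3 \<Rightarrow> complex) \<Rightarrow> (real^3 \<Rightarrow> complex) \<Rightarrow> bool" where
  "schroedinger_solution_on S q u \<longleftrightarrow>
     C2_on S u \<and> (\<forall>p\<in>S. - laplacian u p + q p * u p = 0)"

(* The multivalued operator A: the set of all scalar potentials of the field on S. *)
definition scalar_potentials :: "(real^3) set \<Rightarrow> (real^3 \<Rightarrow> complex^3) \<Rightarrow> (real^3 \<Rightarrow> complex) set" where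
  "scalar_potentials S \<Psi> = {\<phi>. \<forall>p\<in>S. \<phi> differentiable (at p) \<and> grad \<phi> p = \<Psi> p}"

(* The reconstruction formula for A, with base point p0 and additive constant c.
   It evaluates the field only along staircase p0 p, so it makes sense at p when that
   path stays in the domain of the field. The integrals are oriented. *)
definition integral_potential ::
    "(real^3 \<Rightarrow> complex^3) \<Rightarrow> real^3 \<Rightarrow> complex \<Rightarrow> real^3 \<Rightarrow> complex" where
  "integral_potential \<Psi> p0 c p =
     (LBINT \<xi>=p0$1..p$1. \<Psi> (vector [\<xi>, p0$2, p0$3]) $ 1) +
     (LBINT \<eta>=p0$2..p$2. \<Psi> (vector [p$1, \<eta>, p0$3]) $ 2) +
     (LBINT \<zeta>=p0$3..p$3. \<Psi> (vector [p$1, p$2, \<zeta>]) $ 3) + c"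

definition staircase :: "real^3 \<Rightarrow> real^3 \<Rightarrow> (real^3) set" where
  "staircase p0 p =
     closed_segment p0 (vector [p$1, p0$2, p0$3]) \<union>
     closed_segment (vector [p$1, p0$2, p0$3]) (vector [p$1, p$2, p0$3]) \<union>
     closed_segment (vector [p$1, p$2, p0$3]) p"

end

theory Submission
  imports Defs
begin

text \<open>
  Write \<open>f = F \<circ> \<rho>\<close>. A global scalar potential of \<open>\<nabla>\<rho> / f\<^sup>2\<close> is \<open>H \<circ> \<rho>\<close>, where \<open>H\<close> is
  an antiderivative of \<open>1 / F\<^sup>2\<close>; nothing is assumed about \<open>F\<close>, but it is continuous on \<open>\<rho> ` K\<close>
  for every compact \<open>K \<subseteq> \<Omega>\<close>, because \<open>\<rho>\<close> restricted to \<open>K\<close> is a quotient map onto its image.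
  Existence of this potential gives \<open>rot = 0\<close> by symmetry of second derivatives, without simple
  connectedness, and reduces the reconstruction formula to the fundamental theorem of calculus.
  For any potential \<open>\<phi>\<close>, harmonicity of \<open>\<rho>\<close> gives
  \<open>f \<Delta>\<phi> = - 2 \<nabla>f \<cdot> \<nabla>\<phi>\<close>, hence \<open>\<Delta>(f \<phi>) = \<phi> \<Delta>f = q f \<phi>\<close>.
\<close>

section \<open>Partial derivatives and classes of differentiable functions\<close>

text \<open>\<open>vector_derivative\<close> is a choice operator, so \<open>partial_deriv\<close>
  has a controlled value only if the derivative along the line exists. The chain rule identifies
  that value with the Frechet derivative at a basis vector; the algebraic rules below are the rules
  for \<open>has_derivative\<close> evaluated there.\<close>

lemma partial_deriv_eq_derivative:
  assumes "(u has_derivative D) (at p)"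
  shows "partial_deriv i u p = D (axis i 1)"
proof -
  have "((\<lambda>t. p + t *\<^sub>R axis i 1) has_derivative (\<lambda>t. t *\<^sub>R axis i (1::real))) (at 0)"
    by (auto intro!: derivative_eq_intros)
  moreover have "(u has_derivative D) (at (p + 0 *\<^sub>R axis i 1))"
    using assms by simp
  ultimately have "((\<lambda>t. u (p + t *\<^sub>R axis i 1)) has_derivative (\<lambda>t. D (t *\<^sub>R axis i 1))) (at 0)"
    by (rule has_derivative_compose)
  moreover have "(\<lambda>t. D (t *\<^sub>R axis i 1)) = (\<lambda>t. t *\<^sub>R D (axis i 1))"
    using has_derivative_linear[OF assms] by (simp add: linear_scale)
  ultimately have "((\<lambda>t. u (p + t *\<^sub>R axis i 1)) has_vector_derivative D (axis i 1)) (at 0)"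
    by (simp add: has_vector_derivative_def)
  then show ?thesis
    unfolding partial_deriv_def by (rule vector_derivative_at)
qed

text \<open>The parameter \<open>s\<close> and the set \<open>T\<close> are free so that the result
  fits the mean value theorem and the fundamental theorem of calculus on closed intervals.\<close>

lemma has_vector_derivative_along_axis:
  assumes "u differentiable (at (p + s *\<^sub>R axis i 1))"
  shows "((\<lambda>t. u (p + t *\<^sub>R axis i 1)) has_vector_derivative
           partial_deriv i u (p + s *\<^sub>R axis i 1)) (at s within T)"
proof -
  obtain D where D: "(u has_derivative D) (at (p + s *\<^sub>R axis i 1))"
    using assms by (auto simp: differentiable_def)
  have "((\<lambda>t. p + t *\<^sub>R axis i 1) has_derivative (\<lambda>t. t *\<^sub>R axis i (1::real))) (at s within T)"
    by (auto intro!: derivative_eq_intros)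
  from has_derivative_compose[OF this D]
  have "((\<lambda>t. u (p + t *\<^sub>R axis i 1)) has_derivative (\<lambda>t. D (t *\<^sub>R axis i 1))) (at s within T)" .
  moreover have "(\<lambda>t. D (t *\<^sub>R axis i 1)) = (\<lambda>t. t *\<^sub>R partial_deriv i u (p + s *\<^sub>R axis i 1))"
    using has_derivative_linear[OF D] by (simp add: linear_scale partial_deriv_eq_derivative[OF D])
  ultimately show ?thesis
    by (simp add: has_vector_derivative_def)
qed

section \<open>Locality on open sets, and the classes C1 and C2\<close>

lemma has_derivative_cong_open:
  assumes "open S" "p \<in> S" "\<And>x. x \<in> S \<Longrightarrow> u x = v x"
  shows "(u has_derivative D) (at p) \<longleftrightarrow> (v has_derivative D) (at p)"
  using assms by (metis has_derivative_transform_within_open)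

text \<open>The line through \<open>p\<close> stays in \<open>S\<close> for small parameters, so
  both restrictions to it have exactly the same vector derivatives at 0. The choice made by
  \<open>vector_derivative\<close> is then the same too, even where no derivative exists.\<close>

lemma partial_deriv_cong_open:
  assumes "open S" "p \<in> S" "\<And>x. x \<in> S \<Longrightarrow> u x = v x"
  shows "partial_deriv i u p = partial_deriv i v p"
proof -
  let ?L = "\<lambda>t::real. p + t *\<^sub>R axis i 1"
  have "continuous (at 0) ?L"
    by (intro continuous_intros)
  then have "\<forall>\<^sub>F t in nhds 0. ?L t \<in> S"
    using assms(1,2) by (auto simp: continuous_at_open eventually_nhds)
  then have "\<forall>\<^sub>F t in nhds 0. u (?L t) = v (?L t)"
    by eventually_elim (rule assms(3))
  then have "((\<lambda>t. u (?L t)) has_vector_derivative D) (at 0)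
      \<longleftrightarrow> ((\<lambda>t. v (?L t)) has_vector_derivative D) (at 0)" for D
    using assms(2,3) by (intro has_vector_derivative_cong_ev) (auto elim: eventually_mono)
  then show ?thesis
    by (simp add: partial_deriv_def vector_derivative_def)
qed

text \<open>Differentiability and partial derivatives at a point of an open set depend only on
  values in that set. This lets a partial derivative be replaced by a formula that is valid only on
  \<open>S\<close>.\<close>

lemma C1_on_cong:
  assumes "open S" "\<And>x. x \<in> S \<Longrightarrow> u x = v x" "C1_on S v"
  shows "C1_on S u"
  unfolding C1_on_def
proof (intro conjI ballI allI)
  show "u differentiable (at p)" if "p \<in> S" for p
    using assms that has_derivative_cong_open[OF assms(1) that assms(2)]
    by (auto simp: C1_on_def differentiable_def)
  show "continuous_on S (partial_deriv i u)" for i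
    using assms(3) partial_deriv_cong_open[OF assms(1) _ assms(2)]
    by (auto simp: C1_on_def cong: continuous_on_cong)
qed

lemma C1_on_subset: "C1_on S u \<Longrightarrow> T \<subseteq> S \<Longrightarrow> C1_on T u"
  by (meson C1_on_def continuous_on_subset subsetD)

lemma C2_on_subset: "C2_on S u \<Longrightarrow> T \<subseteq> S \<Longrightarrow> C2_on T u"
  by (meson C2_on_def C1_on_subset)

lemma C1_on_imp_continuous_on: "C1_on S u \<Longrightarrow> continuous_on S u"
  by (meson C1_on_def continuous_at_imp_continuous_on differentiable_imp_continuous_within)

lemma C2_onD:
  assumes "C2_on S u"
  shows "C1_on S u" "C1_on S (partial_deriv i u)"
  using assms by (auto simp: C2_on_def)

section \<open>Derivative rules and the closure properties of C1 and C2\<close>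

lemma partial_deriv_bounded_linear:
  assumes "bounded_linear h" "u differentiable (at p)"
  shows "partial_deriv i (\<lambda>x. h (u x)) p = h (partial_deriv i u p)"
proof -
  obtain D where D: "(u has_derivative D) (at p)"
    using assms by (auto simp: differentiable_def)
  show ?thesis
    using partial_deriv_eq_derivative[OF D]
      partial_deriv_eq_derivative[OF bounded_linear.has_derivative[OF assms(1) D]] by simp
qed

lemma C1_on_bounded_linear:
  assumes "bounded_linear h" "C1_on S u"
  shows "C1_on S (\<lambda>x. h (u x))"
  unfolding C1_on_def
proof (intro conjI ballI allI)
  show "(\<lambda>x. h (u x)) differentiable (at p)" if "p \<in> S" for p
    using assms that bounded_linear.has_derivative[OF assms(1)]
    by (fastforce simp: C1_on_def differentiable_def)
  have "continuous_on S (\<lambda>p. h (partial_deriv i u p))" for i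
    using assms by (auto simp: C1_on_def intro: bounded_linear.continuous_on)
  then show "continuous_on S (partial_deriv i (\<lambda>x. h (u x)))" for i
    using assms by (auto simp: C1_on_def partial_deriv_bounded_linear cong: continuous_on_cong)
qed

lemma C2_on_bounded_linear:
  assumes "bounded_linear h" "open S" "C2_on S u"
  shows "C2_on S (\<lambda>x. h (u x))"
  unfolding C2_on_def
proof (intro conjI allI)
  show "C1_on S (\<lambda>x. h (u x))"
    using assms C1_on_bounded_linear C2_onD by blast
  show "C1_on S (partial_deriv i (\<lambda>x. h (u x)))" for i
  proof (rule C1_on_cong[OF assms(2)])
    show "C1_on S (\<lambda>x. h (partial_deriv i u x))"
      using assms C1_on_bounded_linear C2_onD by blast
    show "partial_deriv i (\<lambda>x. h (u x)) x = h (partial_deriv i u x)" if "x \<in> S" for x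
      using assms that by (auto simp: C2_on_def C1_on_def intro: partial_deriv_bounded_linear)
  qed
qed

lemma partial_deriv_add:
  assumes "u differentiable (at p)" "v differentiable (at p)"
  shows "partial_deriv i (\<lambda>x. u x + v x) p = partial_deriv i u p + partial_deriv i v p"
proof -
  obtain D E where D: "(u has_derivative D) (at p)" and E: "(v has_derivative E) (at p)"
    using assms by (auto simp: differentiable_def)
  show ?thesis
    using partial_deriv_eq_derivative[OF D] partial_deriv_eq_derivative[OF E]
      partial_deriv_eq_derivative[OF has_derivative_add[OF D E]] by simp
qed

lemma C1_on_add:
  assumes "C1_on S u" "C1_on S v"
  shows "C1_on S (\<lambda>x. u x + v x)"
proof -
  have "continuous_on S (\<lambda>p. partial_deriv i u p + partial_deriv i v p)" for i
    using assms by (auto simp: C1_on_def intro: continuous_intros)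
  then show ?thesis
    using assms by (auto simp: C1_on_def partial_deriv_add cong: continuous_on_cong)
qed

lemma partial_deriv_mult:
  fixes u v :: "real^3 \<Rightarrow> 'a::real_normed_algebra"
  assumes "u differentiable (at p)" "v differentiable (at p)"
  shows "partial_deriv i (\<lambda>x. u x * v x) p = u p * partial_deriv i v p + partial_deriv i u p * v p"
proof -
  obtain D E where D: "(u has_derivative D) (at p)" and E: "(v has_derivative E) (at p)"
    using assms by (auto simp: differentiable_def)
  show ?thesis
    using partial_deriv_eq_derivative[OF D] partial_deriv_eq_derivative[OF E]
      partial_deriv_eq_derivative[OF has_derivative_mult[OF D E]] by simp
qed

lemma C1_on_mult:
  fixes u v :: "real^3 \<Rightarrow> 'a::real_normed_algebra"
  assumes "C1_on S u" "C1_on S v"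
  shows "C1_on S (\<lambda>x. u x * v x)"
proof -
  have "continuous_on S (\<lambda>p. u p * partial_deriv i v p + partial_deriv i u p * v p)" for i
    using assms C1_on_imp_continuous_on[OF assms(1)] C1_on_imp_continuous_on[OF assms(2)]
    by (auto simp: C1_on_def intro!: continuous_intros)
  then show ?thesis
    using assms by (auto simp: C1_on_def partial_deriv_mult intro: differentiable_mult cong: continuous_on_cong)
qed

lemma C2_on_mult:
  fixes u v :: "real^3 \<Rightarrow> 'a::real_normed_algebra"
  assumes "open S" "C2_on S u" "C2_on S v"
  shows "C2_on S (\<lambda>x. u x * v x)"
  unfolding C2_on_def
proof (intro conjI allI)
  show "C1_on S (\<lambda>x. u x * v x)"
    using assms C1_on_mult C2_onD by blast
  show "C1_on S (partial_deriv i (\<lambda>x. u x * v x))" for i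
  proof (rule C1_on_cong[OF assms(1)])
    show "C1_on S (\<lambda>p. u p * partial_deriv i v p + partial_deriv i u p * v p)"
      by (intro C1_on_add C1_on_mult C2_onD assms)
    show "partial_deriv i (\<lambda>x. u x * v x) p = u p * partial_deriv i v p + partial_deriv i u p * v p"
      if "p \<in> S" for p
      using assms that by (auto simp: C2_on_def C1_on_def intro: partial_deriv_mult)
  qed
qed

lemma partial_deriv_inverse:
  fixes u :: "real^3 \<Rightarrow> 'a::real_normed_field"
  assumes "u differentiable (at p)" "u p \<noteq> 0"
  shows "partial_deriv i (\<lambda>x. inverse (u x)) p = - partial_deriv i u p / (u p)\<^sup>2"
proof -
  obtain D where D: "(u has_derivative D) (at p)"
    using assms by (auto simp: differentiable_def)
  show ?thesis
    using partial_deriv_eq_derivative[OF D]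
      partial_deriv_eq_derivative[OF Deriv.has_derivative_inverse[OF assms(2) D]]
    by (simp add: power2_eq_square divide_simps)
qed

lemma C1_on_inverse:
  fixes u :: "real^3 \<Rightarrow> 'a::real_normed_field"
  assumes "C1_on S u" "\<And>p. p \<in> S \<Longrightarrow> u p \<noteq> 0"
  shows "C1_on S (\<lambda>x. inverse (u x))"
proof -
  have "continuous_on S (\<lambda>p. - partial_deriv i u p / (u p)\<^sup>2)" for i
    using assms C1_on_imp_continuous_on[OF assms(1)]
    by (auto simp: C1_on_def intro!: continuous_intros)
  then show ?thesis
    using assms by (auto simp: C1_on_def partial_deriv_inverse intro: differentiable_inverse cong: continuous_on_cong)
qed

section \<open>Symmetry of second derivatives\<close>

text \<open>The mean value theorem is applied twice, first in direction \<open>i\<close> and then in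
  direction \<open>j\<close>. The second difference on the left is symmetric in \<open>i\<close> and
  \<open>j\<close>, which is what makes it useful for comparing mixed derivatives.\<close>

lemma second_difference_mean_value:
  fixes u :: "real^3 \<Rightarrow> real"
  assumes "ball p r \<subseteq> S" "C2_on S u" "0 < t" "2 * t < r"
  obtains x where "dist x p \<le> 2 * t" "x \<in> S"
    "u (p + t *\<^sub>R axis i 1 + t *\<^sub>R axis j 1) - u (p + t *\<^sub>R axis i 1) - u (p + t *\<^sub>R axis j 1) + u p
       = t\<^sup>2 * partial_deriv j (partial_deriv i u) x"
proof -
  let ?P = "\<lambda>a b. p + a *\<^sub>R axis i 1 + b *\<^sub>R axis j (1::real)"
  have near: "dist (?P a b) p \<le> 2 * t" "?P a b \<in> S" if "a \<in> {0..t}" "b \<in> {0..t}" for a b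
  proof -
    \<comment> \<open>Both directions have norm one, so the triangle inequality keeps the whole
      parameter square within distance \<open>2 * t\<close> of \<open>p\<close>, even for
      \<open>i = j\<close>.\<close>
    have "norm (a *\<^sub>R axis i (1::real) + b *\<^sub>R axis j 1) \<le> \<bar>a\<bar> + \<bar>b\<bar>"
      by (rule norm_triangle_le) simp
    then show "dist (?P a b) p \<le> 2 * t"
      using that by (simp add: dist_norm add.assoc)
    then have "?P a b \<in> ball p r"
      using assms(4) by (simp add: dist_commute)
    then show "?P a b \<in> S"
      using assms(1) by blast
  qed
  have d1: "u differentiable (at x)" and d2: "partial_deriv i u differentiable (at x)"
    if "x \<in> S" for x
    using assms(2) that by (auto simp: C2_on_def C1_on_def)
  \<comment> \<open>\<open>g\<close> is the increment in direction \<open>j\<close>, so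
    \<open>g t - g 0\<close> is the second difference of \<open>u\<close>.\<close>
  define g where "g = (\<lambda>s. u (?P s t) - u (?P s 0))"
  have g: "(g has_derivative (\<lambda>h. h * (partial_deriv i u (?P s t) - partial_deriv i u (?P s 0))))
      (at s within {0..t})" if "0 \<le> s" "s \<le> t" for s
  proof -
    have "((\<lambda>s. u (?P s b)) has_vector_derivative partial_deriv i u (?P s b)) (at s within {0..t})"
      if "b \<in> {0..t}" for b
      using has_vector_derivative_along_axis[of u "p + b *\<^sub>R axis j 1" s i "{0..t}"]
        d1[OF near(2)[of s b]] \<open>0 \<le> s\<close> \<open>s \<le> t\<close> that by (simp add: ac_simps)
    from has_vector_derivative_diff[OF this[of t] this[of 0]] show ?thesis
      using assms(3) by (simp add: g_def has_vector_derivative_def)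
  qed
  obtain s where s: "s \<in> {0<..<t}"
    "g t - g 0 = t * (partial_deriv i u (?P s t) - partial_deriv i u (?P s 0))"
    using mvt_simple[OF assms(3) g] by auto
  have h: "((\<lambda>b. partial_deriv i u (?P s b)) has_derivative
      (\<lambda>h. h * partial_deriv j (partial_deriv i u) (?P s b))) (at b within {0..t})"
    if "0 \<le> b" "b \<le> t" for b
    using has_vector_derivative_along_axis[of "partial_deriv i u" "p + s *\<^sub>R axis i 1" b j "{0..t}"]
      d2[OF near(2)[of s b]] s that by (simp add: has_vector_derivative_def)
  obtain b where b: "b \<in> {0<..<t}"
    "partial_deriv i u (?P s t) - partial_deriv i u (?P s 0)
       = t * partial_deriv j (partial_deriv i u) (?P s b)"
    using mvt_simple[OF assms(3) h] by auto
  show ?thesis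
  proof
    show "dist (?P s b) p \<le> 2 * t" "?P s b \<in> S"
      using near[of s b] s b by auto
    show "u (?P t t) - u (p + t *\<^sub>R axis i 1) - u (p + t *\<^sub>R axis j 1) + u p
       = t\<^sup>2 * partial_deriv j (partial_deriv i u) (?P s b)"
      using s(2) b(2) by (simp add: g_def power2_eq_square)
  qed
qed

text \<open>Each mixed derivative takes, at some point within \<open>2 * t\<close> of
  \<open>p\<close>, the value of the same second difference divided by \<open>t\<^sup>2\<close>.
  Continuity at \<open>p\<close> then rules out two different values there.\<close>

lemma partial_deriv_commute_real:
  fixes u :: "real^3 \<Rightarrow> real"
  assumes "open S" "C2_on S u" "p \<in> S"
  shows "partial_deriv i (partial_deriv j u) p = partial_deriv j (partial_deriv i u) p"
proof (rule ccontr)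
  let ?A = "partial_deriv i (partial_deriv j u)" and ?B = "partial_deriv j (partial_deriv i u)"
  assume neq: "?A p \<noteq> ?B p"
  \<comment> \<open>Half the gap: numbers at distance less than \<open>e\<close> from
    \<open>?A p\<close> and from \<open>?B p\<close> cannot coincide.\<close>
  define e where "e = \<bar>?A p - ?B p\<bar> / 2"
  have "e > 0"
    using neq by (simp add: e_def)
  have "continuous_on S ?A" "continuous_on S ?B"
    using assms(2) by (auto simp: C2_on_def C1_on_def)
  then obtain d1 d2 where d1: "d1 > 0" "\<And>x. x \<in> S \<Longrightarrow> dist x p < d1 \<Longrightarrow> \<bar>?A x - ?A p\<bar> < e"
    and d2: "d2 > 0" "\<And>x. x \<in> S \<Longrightarrow> dist x p < d2 \<Longrightarrow> \<bar>?B x - ?B p\<bar> < e"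
    using \<open>e > 0\<close> assms(3) unfolding continuous_on_iff dist_real_def by metis
  obtain r where r: "r > 0" "ball p r \<subseteq> S"
    using assms(1,3) open_contains_ball by blast
  \<comment> \<open>Dividing by 4 makes \<open>2 * t\<close> strictly smaller than all three
    radii.\<close>
  define t where "t = min r (min d1 d2) / 4"
  have t: "0 < t" "2 * t < r" "2 * t < d1" "2 * t < d2"
    using r d1(1) d2(1) by (auto simp: t_def)
  obtain x where x: "dist x p \<le> 2 * t" "x \<in> S"
    "u (p + t *\<^sub>R axis j 1 + t *\<^sub>R axis i 1) - u (p + t *\<^sub>R axis j 1) - u (p + t *\<^sub>R axis i 1) + u p
       = t\<^sup>2 * ?A x"
    using second_difference_mean_value[OF r(2) assms(2) t(1,2)] .
  obtain y where y: "dist y p \<le> 2 * t" "y \<in> S"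
    "u (p + t *\<^sub>R axis i 1 + t *\<^sub>R axis j 1) - u (p + t *\<^sub>R axis i 1) - u (p + t *\<^sub>R axis j 1) + u p
       = t\<^sup>2 * ?B y"
    using second_difference_mean_value[OF r(2) assms(2) t(1,2)] .
  have eq: "p + t *\<^sub>R axis j 1 + t *\<^sub>R axis i 1 = p + t *\<^sub>R axis i 1 + t *\<^sub>R axis j 1"
    by (simp add: ac_simps)
  have "t\<^sup>2 * ?A x = t\<^sup>2 * ?B y"
    using x(3)[unfolded eq] y(3) by linarith
  then have "?A x = ?B y"
    using t(1) by simp
  then show False
    using d1(2)[of x] d2(2)[of y] x y t by (auto simp: e_def abs_if split: if_splits)
qed

text \<open>The mean value theorem needs real values, so the real case is applied to the real and
  imaginary parts; both are bounded linear and hence commute with partial derivatives.\<close>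

lemma partial_deriv_commute:
  fixes u :: "real^3 \<Rightarrow> complex"
  assumes "open S" "C2_on S u" "p \<in> S"
  shows "partial_deriv i (partial_deriv j u) p = partial_deriv j (partial_deriv i u) p"
proof -
  have *: "h (partial_deriv i (partial_deriv j u) p) = h (partial_deriv j (partial_deriv i u) p)"
    if h: "bounded_linear h" for h :: "complex \<Rightarrow> real"
  proof -
    have eq: "h (partial_deriv k (partial_deriv l u) p) = partial_deriv k (partial_deriv l (\<lambda>x. h (u x))) p"
      for k l
    proof -
      have "partial_deriv k (partial_deriv l (\<lambda>x. h (u x))) p = partial_deriv k (\<lambda>x. h (partial_deriv l u x)) p"
        using assms by (intro partial_deriv_cong_open[OF assms(1,3)] partial_deriv_bounded_linear h)
          (auto simp: C2_on_def C1_on_def)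
      also have "\<dots> = h (partial_deriv k (partial_deriv l u) p)"
        using assms by (intro partial_deriv_bounded_linear h) (auto simp: C2_on_def C1_on_def)
      finally show ?thesis ..
    qed
    show ?thesis
      unfolding eq by (rule partial_deriv_commute_real[OF assms(1) C2_on_bounded_linear[OF h assms(1,2)] assms(3)])
  qed
  show ?thesis
    using *[OF bounded_linear_Re] *[OF bounded_linear_Im] by (rule complex_eqI)
qed

section \<open>Scalar potentials\<close>

lemma scalar_potentialsD:
  assumes "\<phi> \<in> scalar_potentials S \<Psi>" "p \<in> S"
  shows "\<phi> differentiable (at p)" "partial_deriv i \<phi> p = \<Psi> p $ i"
  using assms by (auto simp: scalar_potentials_def grad_def vec_eq_iff)

text \<open>On \<open>S\<close> the partial derivatives of \<phi> are the components of \<Psi>, so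
  the potential is one order smoother than the field.\<close>

lemma C2_on_scalar_potential:
  assumes "open S" "\<phi> \<in> scalar_potentials S \<Psi>" "\<And>i. C1_on S (\<lambda>x. \<Psi> x $ i)"
  shows "C2_on S \<phi>"
proof -
  have C1: "C1_on S (partial_deriv i \<phi>)" for i
    using scalar_potentialsD(2)[OF assms(2)] assms by (auto intro: C1_on_cong[OF _ _ assms(3)[of i]])
  then show ?thesis
    using C1_on_imp_continuous_on[OF C1] scalar_potentialsD(1)[OF assms(2)]
    by (simp add: C2_on_def C1_on_def[of S \<phi>])
qed

text \<open>On \<open>S\<close> the entries of the curl are differences of mixed second derivatives
  of the potential, which commute.\<close>

lemma rot_scalar_potential:
  assumes "open S" "\<phi> \<in> scalar_potentials S \<Psi>" "\<And>i. C1_on S (\<lambda>x. \<Psi> x $ i)" "p \<in> S"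
  shows "rot \<Psi> p = 0"
proof -
  have "partial_deriv j (\<lambda>x. \<Psi> x $ k) p = partial_deriv j (partial_deriv k \<phi>) p" for j k
    using scalar_potentialsD(2)[OF assms(2)] by (intro partial_deriv_cong_open[OF assms(1,4)]) simp
  then have "partial_deriv j (\<lambda>x. \<Psi> x $ k) p = partial_deriv k (\<lambda>x. \<Psi> x $ j) p" for j k
    using partial_deriv_commute[OF assms(1) C2_on_scalar_potential[OF assms(1-3)] assms(4)] by simp
  then show ?thesis
    by (simp add: rot_def vec_eq_iff forall_3)
qed

section \<open>Line integrals along axis-parallel segments and the reconstruction formula\<close>

lemma integral_along_axis_scalar_potential:
  assumes "\<phi> \<in> scalar_potentials S \<Psi>" "\<And>i. continuous_on S (\<lambda>x. \<Psi> x $ i)"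
    and "\<And>t. t \<in> closed_segment a b \<Longrightarrow> x0 + t *\<^sub>R axis i 1 \<in> S"
  shows "(LBINT t=a..b. \<Psi> (x0 + t *\<^sub>R axis i 1) $ i)
    = \<phi> (x0 + b *\<^sub>R axis i 1) - \<phi> (x0 + a *\<^sub>R axis i 1)"
proof (rule interval_integral_FTC_finite)
  \<comment> \<open>The integral is oriented and \<open>b < a\<close> is allowed, so the range is
    the unordered interval, which equals \<open>closed_segment a b\<close>.\<close>
  have in_S: "x0 + t *\<^sub>R axis i 1 \<in> S" if "t \<in> {min a b..max a b}" for t
    using assms(3)[of t] that by (auto simp: closed_segment_eq_real_ivl min_def max_def split: if_splits)
  show "continuous_on {min a b..max a b} (\<lambda>t. \<Psi> (x0 + t *\<^sub>R axis i 1) $ i)"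
    by (rule continuous_on_compose2[OF assms(2)[of i]]) (use in_S in \<open>auto intro!: continuous_intros\<close>)
  show "((\<lambda>t. \<phi> (x0 + t *\<^sub>R axis i 1)) has_vector_derivative \<Psi> (x0 + t *\<^sub>R axis i 1) $ i)
      (at t within {min a b..max a b})" if "min a b \<le> t" "t \<le> max a b" for t
    using has_vector_derivative_along_axis[of \<phi> x0 t i "{min a b..max a b}"]
      scalar_potentialsD[OF assms(1) in_S[of t]] that by auto
qed

text \<open>Coordinates other than \<open>i\<close> are constant along such a segment, so the weight
  that yields the \<open>i\<close>-th coordinate yields the whole point. This places the integration
  paths on the edges of \<open>staircase\<close>.\<close>

lemma closed_segment_axis_aligned:
  fixes x y :: "real^3"
  assumes "t \<in> closed_segment (x $ i) (y $ i)" "\<forall>j. j \<noteq> i \<longrightarrow> z $ j = x $ j \<and> y $ j = x $ j" "z $ i = t"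
  shows "z \<in> closed_segment x y"
proof -
  obtain s where s: "0 \<le> s" "s \<le> 1" "t = (1 - s) * x $ i + s * y $ i"
    using assms(1) by (auto simp: in_segment)
  have "z $ j = ((1 - s) *\<^sub>R x + s *\<^sub>R y) $ j" for j
    using s assms(2,3) by (cases "j = i") (auto simp: algebra_simps)
  then show ?thesis
    using s(1,2) by (auto simp: in_segment vec_eq_iff)
qed

text \<open>Each of the three integrals is the increment of \<phi> along one edge of the staircase,
  and the sum telescopes.\<close>

lemma integral_potential_eq_scalar_potential:
  assumes "\<phi> \<in> scalar_potentials S \<Psi>" "\<And>i. continuous_on S (\<lambda>x. \<Psi> x $ i)" "staircase p0 p \<subseteq> S"
  shows "integral_potential \<Psi> p0 c p = \<phi> p + (c - \<phi> p0)"
proof -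
  \<comment> \<open>Base points with a zero in the moving coordinate make the line parameter equal
    to that coordinate, as in the integrals to be evaluated.\<close>
  have v1: "vector [0, b, d] + t *\<^sub>R axis (1::3) 1 = vector [t, b, d]"
    and v2: "vector [b, 0, d] + t *\<^sub>R axis (2::3) 1 = vector [b, t, d]"
    and v3: "vector [b, d, 0] + t *\<^sub>R axis (3::3) 1 = vector [b, d, t]" for t b d :: real
    by (simp_all add: vec_eq_iff forall_3 axis_def)
  have eta: "vector [x $ 1, x $ 2, x $ 3] = x" for x :: "real^3"
    by (simp add: vec_eq_iff forall_3)
  have I1: "(LBINT t=p0$1..p$1. \<Psi> (vector [t, p0$2, p0$3]) $ 1)
      = \<phi> (vector [p$1, p0$2, p0$3]) - \<phi> (vector [p0$1, p0$2, p0$3])"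
  proof (rule integral_along_axis_scalar_potential[OF assms(1,2), of _ _ "vector [0, p0$2, p0$3]" 1, unfolded v1])
    fix t assume t: "t \<in> closed_segment (p0$1) (p$1)"
    have "vector [t, p0$2, p0$3] \<in> closed_segment p0 (vector [p$1, p0$2, p0$3])"
      by (rule closed_segment_axis_aligned[of t _ 1]) (use t in \<open>simp_all add: forall_3\<close>)
    then show "vector [t, p0$2, p0$3] \<in> S"
      using assms(3) by (auto simp: staircase_def)
  qed
  have I2: "(LBINT t=p0$2..p$2. \<Psi> (vector [p$1, t, p0$3]) $ 2)
      = \<phi> (vector [p$1, p$2, p0$3]) - \<phi> (vector [p$1, p0$2, p0$3])"
  proof (rule integral_along_axis_scalar_potential[OF assms(1,2), of _ _ "vector [p$1, 0, p0$3]" 2, unfolded v2])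
    fix t assume t: "t \<in> closed_segment (p0$2) (p$2)"
    have "vector [p$1, t, p0$3] \<in> closed_segment (vector [p$1, p0$2, p0$3] :: real^3) (vector [p$1, p$2, p0$3])"
      by (rule closed_segment_axis_aligned[of t _ 2]) (use t in \<open>simp_all add: forall_3\<close>)
    then show "vector [p$1, t, p0$3] \<in> S"
      using assms(3) by (auto simp: staircase_def)
  qed
  have I3: "(LBINT t=p0$3..p$3. \<Psi> (vector [p$1, p$2, t]) $ 3)
      = \<phi> (vector [p$1, p$2, p$3]) - \<phi> (vector [p$1, p$2, p0$3])"
  proof (rule integral_along_axis_scalar_potential[OF assms(1,2), of _ _ "vector [p$1, p$2, 0]" 3, unfolded v3])
    fix t assume t: "t \<in> closed_segment (p0$3) (p$3)"
    have "vector [p$1, p$2, t] \<in> closed_segment (vector [p$1, p$2, p0$3]) p"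
      by (rule closed_segment_axis_aligned[of t _ 3]) (use t in \<open>simp_all add: forall_3\<close>)
    then show "vector [p$1, p$2, t] \<in> S"
      using assms(3) by (auto simp: staircase_def)
  qed
  show ?thesis
    unfolding integral_potential_def I1 I2 I3 eta by simp
qed

text \<open>On the open set \<open>U\<close> the formula differs from \<phi> by a constant, so it
  has the same derivative.\<close>

lemma integral_potential_in_scalar_potentials:
  assumes "\<phi> \<in> scalar_potentials S \<Psi>" "\<And>i. continuous_on S (\<lambda>x. \<Psi> x $ i)"
    and "open U" "\<forall>p\<in>U. staircase p0 p \<subseteq> S"
  shows "integral_potential \<Psi> p0 c \<in> scalar_potentials U \<Psi>"
  unfolding scalar_potentials_def
proof (intro CollectI ballI)
  fix p assume p: "p \<in> U"
  \<comment> \<open>\<open>p\<close> is the endpoint of its own staircase.\<close>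
  then have "p \<in> S"
    using assms(4) by (auto simp: staircase_def)
  then obtain D where D: "(\<phi> has_derivative D) (at p)"
    using scalar_potentialsD(1)[OF assms(1)] by (auto simp: differentiable_def)
  then have shifted: "((\<lambda>x. \<phi> x + (c - \<phi> p0)) has_derivative D) (at p)"
    by (auto intro!: derivative_eq_intros)
  have "integral_potential \<Psi> p0 c x = \<phi> x + (c - \<phi> p0)" if "x \<in> U" for x
    using integral_potential_eq_scalar_potential[OF assms(1,2)] assms(4) that by blast
  then have D': "(integral_potential \<Psi> p0 c has_derivative D) (at p)"
    by (rule has_derivative_cong_open[OF assms(3) p, THEN iffD2, OF _ shifted])
  show "integral_potential \<Psi> p0 c differentiable at p \<and> grad (integral_potential \<Psi> p0 c) p = \<Psi> p"
    using D' scalar_potentialsD(2)[OF assms(1) \<open>p \<in> S\<close>]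
    by (auto simp: differentiable_def grad_def vec_eq_iff partial_deriv_eq_derivative[OF D']
        partial_deriv_eq_derivative[OF D])
qed

section \<open>Existence of a global potential for a field
  \<open>F(\<rho>) \<nabla>\<rho>\<close>\<close>

lemma continuous_on_factor_compact:
  fixes \<rho> :: "'a::topological_space \<Rightarrow> 'b::metric_space" and F :: "'b \<Rightarrow> 'c::topological_space"
  assumes "compact K" "continuous_on K \<rho>" "continuous_on K (\<lambda>x. F (\<rho> x))"
  shows "continuous_on (\<rho> ` K) F"
proof -
  \<comment> \<open>A continuous map from a compact space onto a Hausdorff space is closed, hence a
    quotient map, so continuity of \<open>F\<close> can be tested after composing with
    \<rho>.\<close>
  have "quotient_map (top_of_set K) (top_of_set (\<rho> ` K)) \<rho>"
    using assms by (intro T1_Spaces.continuous_imp_quotient_map)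
      (simp_all add: compact_space_subtopology Hausdorff_space_subtopology)
  moreover have "continuous_map (top_of_set K) euclidean (F \<circ> \<rho>)"
    using assms(3) by (simp add: o_def)
  ultimately show ?thesis
    by (simp add: continuous_compose_quotient_map flip: continuous_map_iff_continuous)
qed

text \<open>By the chain rule an antiderivative \<open>H\<close> of \<open>F\<close> gives the
  potential \<open>H \<circ> \<rho>\<close>. Continuity of \<open>F\<close> is available on images
  of compact sets, so the derivative is computed at one point at a time, through a compact connected
  set.\<close>

lemma scalar_potential_of_composition:
  fixes F :: "real \<Rightarrow> complex"
  assumes "open \<Omega>" "connected \<Omega>" "\<Omega> \<noteq> {}"
    and \<rho>: "\<And>p. p \<in> \<Omega> \<Longrightarrow> \<rho> differentiable (at p)"
    and F: "continuous_on \<Omega> (\<lambda>p. F (\<rho> p))"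
    and \<Psi>: "\<And>p i. p \<in> \<Omega> \<Longrightarrow> \<Psi> p $ i = grad \<rho> p $ i *\<^sub>R F (\<rho> p)"
  obtains \<phi> where "\<phi> \<in> scalar_potentials \<Omega> \<Psi>"
proof -
  obtain p0 where p0: "p0 \<in> \<Omega>"
    using assms(3) by auto
  have cont\<rho>: "continuous_on \<Omega> \<rho>"
    by (meson \<rho> continuous_at_imp_continuous_on differentiable_imp_continuous_within)
  \<comment> \<open>The lower limit is fixed, so one function \<open>H\<close> serves every point
    \<open>p\<close>.\<close>
  define H where "H = (\<lambda>s. LBINT t=\<rho> p0..s. F t)"
  have "(\<lambda>p. H (\<rho> p)) differentiable (at p) \<and> grad (\<lambda>p. H (\<rho> p)) p = \<Psi> p" if p: "p \<in> \<Omega>" for p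
  proof -
    obtain \<gamma> where \<gamma>: "path \<gamma>" "path_image \<gamma> \<subseteq> \<Omega>" "pathstart \<gamma> = p0" "pathfinish \<gamma> = p"
      using connected_open_path_connected[OF assms(1,2)] p0 p unfolding path_connected_def by blast
    obtain r where r: "r > 0" "cball p r \<subseteq> \<Omega>"
      using assms(1) p open_contains_cball by blast
    define K where "K = path_image \<gamma> \<union> cball p r"
    have K: "compact K" "K \<subseteq> \<Omega>" "p0 \<in> K" "p \<in> K"
      using \<gamma> r by (auto simp: K_def compact_path_image)
    have "connected K"
      unfolding K_def using \<gamma> r pathfinish_in_path_image[of \<gamma>]
      by (intro connected_Un connected_path_image) (auto simp: convex_connected)
    then have "connected (\<rho> ` K)" "compact (\<rho> ` K)"
      using K continuous_on_subset[OF cont\<rho>] by (auto intro: connected_continuous_image compact_continuous_image)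
    then obtain a b where ab: "\<rho> ` K = {a..b}"
      by (metis connected_compact_interval_1)
    have contF: "continuous_on {a..b} F"
      unfolding ab[symmetric]
      using K continuous_on_subset[OF cont\<rho>] continuous_on_subset[OF F] by (intro continuous_on_factor_compact)
    have "\<rho> p0 \<in> {a..b}" "\<rho> p \<in> {a..b}"
      using K ab by auto
    then have "(H has_vector_derivative F (\<rho> p)) (at (\<rho> p) within {a..b})"
      unfolding H_def by (intro interval_integral_FTC2 contF) auto
    \<comment> \<open>\<open>\<rho> p\<close> may be an endpoint of the interval, so
      \<open>H\<close> is differentiated only relative to the values of \<rho> on the ball. This
      suffices for the composition, and openness of the ball then gives the unrestricted
      derivative.\<close>
    then have H: "(H has_derivative (\<lambda>h. h *\<^sub>R F (\<rho> p))) (at (\<rho> p) within \<rho> ` ball p r)"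
      unfolding has_vector_derivative_def
      by (rule has_derivative_subset) (use ab in \<open>auto simp: K_def\<close>)
    obtain D where D: "(\<rho> has_derivative D) (at p)"
      using \<rho>[OF p] by (auto simp: differentiable_def)
    have "((\<lambda>x. H (\<rho> x)) has_derivative (\<lambda>h. D h *\<^sub>R F (\<rho> p))) (at p within ball p r)"
      by (rule has_derivative_in_compose[OF has_derivative_at_withinI[OF D] H])
    then have E: "((\<lambda>x. H (\<rho> x)) has_derivative (\<lambda>h. D h *\<^sub>R F (\<rho> p))) (at p)"
      using r(1) at_within_open[of p "ball p r"] by simp
    show ?thesis
      using E \<Psi>[OF p]
      by (auto simp: differentiable_def grad_def vec_eq_iff partial_deriv_eq_derivative[OF E]
          partial_deriv_eq_derivative[OF D])
  qed
  then show ?thesis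
    using that[of "\<lambda>p. H (\<rho> p)"] by (auto simp: scalar_potentials_def)
qed

section \<open>The transformed solution\<close>

text \<open>In each coordinate, the product rule for \<open>f * \<phi>\<close> creates a cross term
  that the derivative of \<open>1 / f\<^sup>2\<close> inside the second derivative of \<phi>
  cancels. The remainder is a pure second derivative of \<rho> divided by \<open>f\<close>, and
  these sum to zero. The set \<open>S\<close> is an arbitrary open set because the result is used on
  \<Omega> and on its subsets.\<close>

lemma schroedinger_solution_times_potential:
  fixes f :: "real^3 \<Rightarrow> complex" and \<rho> :: "real^3 \<Rightarrow> real"
  assumes "open S" and f: "schroedinger_solution_on S q f" "\<And>p. p \<in> S \<Longrightarrow> f p \<noteq> 0"
    and \<rho>: "harmonic_on S \<rho>"
    and \<Psi>: "\<And>p i. \<Psi> p $ i = complex_of_real (grad \<rho> p $ i) / (f p)\<^sup>2"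
    and C1: "\<And>i. C1_on S (\<lambda>x. \<Psi> x $ i)"
    and \<phi>: "\<phi> \<in> scalar_potentials S \<Psi>"
  shows "schroedinger_solution_on S q (\<lambda>p. f p * \<phi> p)"
  unfolding schroedinger_solution_on_def
proof (intro conjI ballI)
  have C2f: "C2_on S f"
    using f by (simp add: schroedinger_solution_on_def)
  have C2\<phi>: "C2_on S \<phi>"
    by (rule C2_on_scalar_potential[OF assms(1) \<phi> C1])
  show "C2_on S (\<lambda>p. f p * \<phi> p)"
    by (intro C2_on_mult assms C2f C2\<phi>)
  fix p assume p: "p \<in> S"
  have df: "f differentiable (at x)" "partial_deriv i f differentiable (at x)"
    and d\<phi>: "\<phi> differentiable (at x)" "partial_deriv i \<phi> differentiable (at x)"
    and d\<rho>: "\<rho> differentiable (at x)" "partial_deriv i \<rho> differentiable (at x)"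
    if "x \<in> S" for x i
    using C2f C2\<phi> \<rho> that by (auto simp: C2_on_def C1_on_def harmonic_on_def)
  let ?r = "\<lambda>i x. complex_of_real (partial_deriv i \<rho> x)"
  \<comment> \<open>The square is written as a product so that \<open>partial_deriv_mult\<close>
    applies to it.\<close>
  have \<phi>_eq: "partial_deriv i \<phi> x = ?r i x * inverse (f x * f x)" if "x \<in> S" for i x
    using scalar_potentialsD(2)[OF \<phi> that] \<Psi>[of x i]
    by (simp add: grad_def power2_eq_square divide_inverse)
  have sum\<rho>: "(\<Sum>i\<in>UNIV. partial_deriv i (partial_deriv i \<rho>) p) = 0"
    using \<rho> p by (simp add: harmonic_on_def laplacian_def)
  \<comment> \<open>The factor \<open>f p\<close> matches the term in which the product rule leaves
    \<phi> differentiated twice.\<close>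
  have second: "f p * partial_deriv i (partial_deriv i \<phi>) p
      = complex_of_real (partial_deriv i (partial_deriv i \<rho>) p) / f p
        - 2 * partial_deriv i f p * partial_deriv i \<phi> p" for i
  proof -
    have d_r: "?r i differentiable (at p)"
      using bounded_linear.has_derivative[OF bounded_linear_of_real] d\<rho>(2)[OF p, of i]
      by (auto simp: differentiable_def)
    have dff: "(\<lambda>x. f x * f x) differentiable (at p)"
      using df p by (intro differentiable_mult) auto
    have "partial_deriv i (partial_deriv i \<phi>) p = partial_deriv i (\<lambda>x. ?r i x * inverse (f x * f x)) p"
      by (rule partial_deriv_cong_open[OF assms(1) p \<phi>_eq])
    also have "\<dots> = ?r i p * partial_deriv i (\<lambda>x. inverse (f x * f x)) p
        + partial_deriv i (?r i) p * inverse (f p * f p)"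
      using d_r dff f(2)[OF p] by (intro partial_deriv_mult differentiable_inverse) auto
    also have "partial_deriv i (\<lambda>x. inverse (f x * f x)) p
        = - (2 * f p * partial_deriv i f p) / (f p * f p)\<^sup>2"
      using partial_deriv_inverse[OF dff] partial_deriv_mult[OF df(1)[OF p] df(1)[OF p], of i] f(2)[OF p]
      by (simp add: algebra_simps)
    also have "partial_deriv i (?r i) p = complex_of_real (partial_deriv i (partial_deriv i \<rho>) p)"
      by (rule partial_deriv_bounded_linear[OF bounded_linear_of_real d\<rho>(2)[OF p]])
    finally show ?thesis
      using f(2)[OF p] by (simp add: \<phi>_eq[OF p] field_simps power2_eq_square)
  qed
  have product: "partial_deriv i (partial_deriv i (\<lambda>x. f x * \<phi> x)) p
      = \<phi> p * partial_deriv i (partial_deriv i f) p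
        + complex_of_real (partial_deriv i (partial_deriv i \<rho>) p) / f p" for i
  proof -
    have "partial_deriv i (partial_deriv i (\<lambda>x. f x * \<phi> x)) p
        = partial_deriv i (\<lambda>x. f x * partial_deriv i \<phi> x + partial_deriv i f x * \<phi> x) p"
      using df d\<phi> by (intro partial_deriv_cong_open[OF assms(1) p] partial_deriv_mult)
    also have "\<dots> = partial_deriv i (\<lambda>x. f x * partial_deriv i \<phi> x) p
        + partial_deriv i (\<lambda>x. partial_deriv i f x * \<phi> x) p"
      using df d\<phi> p by (intro partial_deriv_add differentiable_mult) auto
    also have "partial_deriv i (\<lambda>x. f x * partial_deriv i \<phi> x) p
        = f p * partial_deriv i (partial_deriv i \<phi>) p + partial_deriv i f p * partial_deriv i \<phi> p"
      using df d\<phi> p by (intro partial_deriv_mult)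
    also have "partial_deriv i (\<lambda>x. partial_deriv i f x * \<phi> x) p
        = partial_deriv i f p * partial_deriv i \<phi> p + partial_deriv i (partial_deriv i f) p * \<phi> p"
      using df d\<phi> p by (intro partial_deriv_mult)
    \<comment> \<open>The two equal cross terms cancel against the last term of
      \<open>second\<close>.\<close>
    finally show ?thesis
      unfolding second by (simp add: algebra_simps)
  qed
  have "laplacian (\<lambda>p. f p * \<phi> p) p = \<phi> p * laplacian f p
      + complex_of_real (\<Sum>i\<in>UNIV. partial_deriv i (partial_deriv i \<rho>) p) / f p"
    unfolding laplacian_def product by (simp add: sum.distrib sum_distrib_left sum_divide_distrib)
  \<comment> \<open>Harmonicity enters here, after summation over the coordinates.\<close>
  then have "- laplacian (\<lambda>p. f p * \<phi> p) p + q p * (f p * \<phi> p) = \<phi> p * (- laplacian f p + q p * f p)"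
    unfolding sum\<rho> by (simp add: algebra_simps)
  then show "- laplacian (\<lambda>p. f p * \<phi> p) p + q p * (f p * \<phi> p) = 0"
    using f p by (simp add: schroedinger_solution_on_def)
qed

theorem mainTheorem6:
  fixes \<Omega> :: "(real^3) set"
    and q f :: "real^3 \<Rightarrow> complex"
    and \<rho> :: "real^3 \<Rightarrow> real"
    and \<Psi> :: "real^3 \<Rightarrow> complex^3"
  assumes "open \<Omega>" and "connected \<Omega>" and "\<Omega> \<noteq> {}"
    and "schroedinger_solution_on \<Omega> q f"
    and "\<forall>p\<in>\<Omega>. f p \<noteq> 0"
    and "harmonic_on \<Omega> \<rho>"
    and "\<exists>F :: real \<Rightarrow> complex. \<forall>p\<in>\<Omega>. f p = F (\<rho> p)"
    and "\<forall>p. \<Psi> p = (\<chi> i. complex_of_real (grad \<rho> p $ i) / (f p)\<^sup>2)"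
  shows "(\<forall>p\<in>\<Omega>. rot \<Psi> p = 0)
    \<and> scalar_potentials \<Omega> \<Psi> \<noteq> {}
    \<and> (\<forall>\<phi>\<in>scalar_potentials \<Omega> \<Psi>. schroedinger_solution_on \<Omega> q (\<lambda>p. f p * \<phi> p))
    \<and> (\<forall>U p0 c. open U \<and> (\<forall>p\<in>U. staircase p0 p \<subseteq> \<Omega>) \<longrightarrow>
          integral_potential \<Psi> p0 c \<in> scalar_potentials U \<Psi>
        \<and> schroedinger_solution_on U q (\<lambda>p. f p * integral_potential \<Psi> p0 c p))"
proof -
  have \<Psi>: "\<Psi> p $ i = complex_of_real (grad \<rho> p $ i) / (f p)\<^sup>2" for p i
    using assms(8) by simp
  have f0: "f p \<noteq> 0" if "p \<in> \<Omega>" for p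
    using assms(5) that by blast
  have C2\<rho>: "C2_on \<Omega> \<rho>" and C2f: "C2_on \<Omega> f"
    using assms(4,6) by (auto simp: harmonic_on_def schroedinger_solution_on_def)
  \<comment> \<open>One derivative of \<rho> is already spent in \<Psi>, so \<rho> being C2 leaves
    C1; division by the square of \<open>f\<close> keeps this because \<open>f\<close> does not
    vanish.\<close>
  have C1\<Psi>: "C1_on \<Omega> (\<lambda>x. \<Psi> x $ i)" for i
  proof (rule C1_on_cong[OF assms(1)])
    show "C1_on \<Omega> (\<lambda>x. complex_of_real (partial_deriv i \<rho> x) * inverse (f x * f x))"
      using f0 by (intro C1_on_mult C1_on_inverse C1_on_bounded_linear[OF bounded_linear_of_real]
          C2_onD[OF C2f] C2_onD[OF C2\<rho>]) auto
  qed (simp add: \<Psi> grad_def power2_eq_square divide_inverse)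
  obtain F where F: "\<And>p. p \<in> \<Omega> \<Longrightarrow> f p = F (\<rho> p)"
    using assms(7) by auto
  obtain \<phi> where \<phi>: "\<phi> \<in> scalar_potentials \<Omega> \<Psi>"
  proof (rule scalar_potential_of_composition[OF assms(1-3)])
    show "\<rho> differentiable (at p)" if "p \<in> \<Omega>" for p
      using C2\<rho> that by (simp add: C2_on_def C1_on_def)
    \<comment> \<open>The density integrated along \<rho> is the inverse square of \<open>F\<close>;
      its continuity after composition with \<rho> is read off from \<open>f\<close>.\<close>
    have "continuous_on \<Omega> (\<lambda>p. inverse ((f p)\<^sup>2))"
      using f0 by (intro continuous_intros C1_on_imp_continuous_on C2_onD[OF C2f]) auto
    then show "continuous_on \<Omega> (\<lambda>p. inverse ((F (\<rho> p))\<^sup>2))"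
      using F by (simp cong: continuous_on_cong)
    show "\<Psi> p $ i = grad \<rho> p $ i *\<^sub>R inverse ((F (\<rho> p))\<^sup>2)" if "p \<in> \<Omega>" for p i
      using F[OF that] by (simp add: \<Psi> scaleR_conv_of_real divide_inverse)
  qed
  show ?thesis
  proof (intro conjI ballI allI impI)
    show "rot \<Psi> p = 0" if "p \<in> \<Omega>" for p
      using rot_scalar_potential[OF assms(1) \<phi> C1\<Psi> that] .
    show "scalar_potentials \<Omega> \<Psi> \<noteq> {}"
      using \<phi> by blast
    show "schroedinger_solution_on \<Omega> q (\<lambda>p. f p * \<phi> p)" if "\<phi> \<in> scalar_potentials \<Omega> \<Psi>" for \<phi>
      using schroedinger_solution_times_potential[OF assms(1,4) f0 assms(6) \<Psi> C1\<Psi> that] .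
    fix U p0 c
    assume U: "open U \<and> (\<forall>p\<in>U. staircase p0 p \<subseteq> \<Omega>)"
    then have sub: "U \<subseteq> \<Omega>"
      by (auto simp: staircase_def)
    show ip: "integral_potential \<Psi> p0 c \<in> scalar_potentials U \<Psi>"
      using integral_potential_in_scalar_potentials[OF \<phi> C1_on_imp_continuous_on[OF C1\<Psi>]] U by blast
    \<comment> \<open>Both hypotheses restrict to \<open>U\<close>, and the integral formula is a
      potential there, so the product argument runs on \<open>U\<close> itself, connected or
      not.\<close>
    have "schroedinger_solution_on U q f" "harmonic_on U \<rho>"
      using assms(4,6) sub C2_on_subset unfolding schroedinger_solution_on_def harmonic_on_def by blast+
    then show "schroedinger_solution_on U q (\<lambda>p. f p * integral_potential \<Psi> p0 c p)"
      using U sub f0 C1_on_subset[OF C1\<Psi> sub]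
      by (intro schroedinger_solution_times_potential[OF _ _ _ _ \<Psi> _ ip]) auto
  qed
qed

end
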